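(* Let $d\geq 2$, $t\geq 2$ and $\ell\geq 1$ be integers. Let $G=(V,E)$ be an $S_{1^t,\ell}$-free graph with maximum degree $\Delta$ such that either $\Delta = 2$, or both $3\leq \Delta\leq \frac{t}{t-1}d+\frac{1}{t-1}$ and $|V| > (d+1)\left(\frac{\Delta(\Delta-1)^{\ell+1}-2}{\Delta-2}\right)$. Then $G$ has a $d$-cut, and such a $d$-cut can be found in linear time.
   Context: All graphs are finite, simple and undirected. For positive integers $t$ and $\ell$, $S_{1^t,\ell}$ denotes the graph obtained from the star $K_{1,t+1}$ (a centre adjacent to $t+1$ leaves) by replacing one of its edges with a path of length $\ell$ (i.e. subdividing that edge exactly $\ell-1$ times); it has exactly $t+\ell$ edges, and $S_{1^t,1}=K_{1,t+1}$. A graph is $H$-free if it contains no induced subgraph isomorphic to $H$. For an integer $d\geq 1$, a set $M\subseteq E$ is a $d$-cut of $G$ if $V$ can be partitioned into two non-empty sets $B$ and $R$ such that $M$ is exactly the set of edges with one end in $B$ and the other in $R$, and every vertex of $B$ has at most $d$ neighbours in $R$ and every vertex of $R$ has at most $d$ neighbours in $B$. *)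

theory Defs
  imports Complex_Main
begin

section \<open>Finite simple undirected graphs\<close>

definition simple_graph :: "'a set \<Rightarrow> 'a set set \<Rightarrow> bool" where
  "simple_graph V E \<longleftrightarrow> finite V \<and> E \<subseteq> {{u, v} | u v. u \<in> V \<and> v \<in> V \<and> u \<noteq> v}"

definition nbrs :: "'a set set \<Rightarrow> 'a \<Rightarrow> 'a set" where
  "nbrs E v = {u. {v, u} \<in> E}"

definition degree :: "'a set set \<Rightarrow> 'a \<Rightarrow> nat" where
  "degree E v = card (nbrs E v)"

text \<open>The inserted 0 only serves to give the graph without vertices maximum degree 0.\<close>

definition max_degree :: "'a set \<Rightarrow> 'a set set \<Rightarrow> nat" where
  "max_degree V E = Max (insert 0 (degree E ` V))"

definition graph_iso :: "'a set \<Rightarrow> 'a set set \<Rightarrow> 'b set \<Rightarrow> 'b set set \<Rightarrow> bool" where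
  "graph_iso V E V' E' \<longleftrightarrow>
     (\<exists>f. bij_betw f V V' \<and> (\<forall>u\<in>V. \<forall>v\<in>V. {u, v} \<in> E \<longleftrightarrow> {f u, f v} \<in> E'))"

definition induced_edges :: "'a set set \<Rightarrow> 'a set \<Rightarrow> 'a set set" where
  "induced_edges E W = {e \<in> E. e \<subseteq> W}"

definition is_free :: "'b set \<Rightarrow> 'b set set \<Rightarrow> 'a set \<Rightarrow> 'a set set \<Rightarrow> bool" where
  "is_free VH EH V E \<longleftrightarrow> \<not> (\<exists>W \<subseteq> V. graph_iso W (induced_edges E W) VH EH)"


section \<open>The graph $S_{1^t,\ell}$\<close>

text \<open>
  The centre is 0, the leaves at distance 1 are 1, ..., t, and the edge from 0 to t + 1 of the
  star is extended to the path 0, t + 1, t + 2, ..., t + l, which has length l.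
\<close>

definition S_verts :: "nat \<Rightarrow> nat \<Rightarrow> nat set" where
  "S_verts t l = {0..t + l}"

definition S_edges :: "nat \<Rightarrow> nat \<Rightarrow> nat set set" where
  "S_edges t l = {{0, i} | i. 1 \<le> i \<and> i \<le> t + 1} \<union> {{i, i + 1} | i. t + 1 \<le> i \<and> i < t + l}"

lemma S_simple: "l \<ge> 1 \<Longrightarrow> simple_graph (S_verts t l) (S_edges t l)"
proof -
  assume l: "l \<ge> 1"
  have "\<exists>u v. e = {u, v} \<and> u \<in> S_verts t l \<and> v \<in> S_verts t l \<and> u \<noteq> v" if "e \<in> S_edges t l" for e
  proof -
    from that consider i where "e = {0, i}" "1 \<le> i" "i \<le> t + 1"
      | i where "e = {i, i + 1}" "t + 1 \<le> i" "i < t + l"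
      unfolding S_edges_def by blast
    then show ?thesis
    proof cases
      case 1
      with l show ?thesis by (intro exI[of _ 0] exI[of _ i]) (simp add: S_verts_def)
    next
      case 2
      then show ?thesis by (intro exI[of _ i] exI[of _ "i + 1"]) (simp add: S_verts_def)
    qed
  qed
  then show ?thesis by (auto simp: simple_graph_def S_verts_def)
qed

lemma S_star: "S_edges t 1 = {{0, i} | i. 1 \<le> i \<and> i \<le> t + 1}"
  by (auto simp: S_edges_def)

lemma card_S_edges:
  assumes "l \<ge> 1"
  shows "card (S_edges t l) = t + l"
proof -
  have 1: "{{0, i} | i. 1 \<le> i \<and> i \<le> t + 1} = (\<lambda>i. {0::nat, i}) ` {1..t + 1}" by auto
  have 2: "{{i, i + 1} | i. t + 1 \<le> i \<and> i < t + l} = (\<lambda>i. {i::nat, i + 1}) ` {t + 1..<t + l}"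
    by auto
  have "card ((\<lambda>i. {0::nat, i}) ` {1..t + 1}) = t + 1"
    by (subst card_image) (auto simp: inj_on_def doubleton_eq_iff)
  moreover have "card ((\<lambda>i. {i::nat, i + 1}) ` {t + 1..<t + l}) = l - 1"
    by (subst card_image) (auto simp: inj_on_def doubleton_eq_iff)
  moreover have "(\<lambda>i. {0::nat, i}) ` {1..t + 1} \<inter> (\<lambda>i. {i::nat, i + 1}) ` {t + 1..<t + l} = {}"
    by (auto simp: doubleton_eq_iff)
  ultimately show ?thesis
    unfolding S_edges_def 1 2 using assms by (subst card_Un_disjoint) auto
qed


section \<open>$d$-cuts\<close>

definition d_cut :: "nat \<Rightarrow> 'a set \<Rightarrow> 'a set set \<Rightarrow> 'a set set \<Rightarrow> bool" where
  "d_cut d V E M \<longleftrightarrow>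
     M \<subseteq> E \<and>
     (\<exists>B R. B \<noteq> {} \<and> R \<noteq> {} \<and> B \<inter> R = {} \<and> B \<union> R = V \<and>
        M = {e \<in> E. \<exists>b\<in>B. \<exists>r\<in>R. e = {b, r}} \<and>
        (\<forall>b\<in>B. card (nbrs E b \<inter> R) \<le> d) \<and>
        (\<forall>r\<in>R. card (nbrs E r \<inter> B) \<le> d))"

definition admissible :: "nat \<Rightarrow> nat \<Rightarrow> nat \<Rightarrow> 'a set \<Rightarrow> 'a set set \<Rightarrow> bool" where
  "admissible d t l V E \<longleftrightarrow>
     simple_graph V E \<and>
     is_free (S_verts t l) (S_edges t l) V E \<and>
     (let D = real (max_degree V E) in
        D = 2 \<or>
        3 \<le> D \<and>
        D \<le> real t / (real t - 1) * real d + 1 / (real t - 1) \<and>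
        real (card V) > (real d + 1) * ((D * (D - 1) ^ (l + 1) - 2) / (D - 2)))"


section \<open>Linear time\<close>

text \<open>
  Running time is measured on a random access machine, programmed in a small imperative language
  with natural-number variables and arrays (random access memory, initially 0).  Every operation
  costs one time unit.  The only arithmetic is successor and predecessor, so in T steps no stored
  number can exceed the largest number in the input and the program by more than T.  Hence, for
  linear T, all numbers have O(log N) bits on inputs of size N, and the uniform cost measure
  cannot be abused by computing with huge numbers.
\<close>

type_synonym state = "(string \<Rightarrow> nat) \<times> (string \<Rightarrow> nat \<Rightarrow> nat)"

datatype aexp =
    Const nat
  | Var string
  | Get string aexp
  | Inc aexp
  | Dec aexp

datatype bexp =
    Less aexp aexp
  | Equal aexp aexp
  | Not bexp
  | And bexp bexp

datatype com =
    Skip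
  | Assign string aexp
  | Put string aexp aexp
  | Seq com com
  | If bexp com com
  | While bexp com

fun aval :: "aexp \<Rightarrow> state \<Rightarrow> nat" where
  "aval (Const k) s = k"
| "aval (Var x) s = fst s x"
| "aval (Get a e) s = snd s a (aval e s)"
| "aval (Inc e) s = aval e s + 1"
| "aval (Dec e) s = aval e s - 1"

fun bval :: "bexp \<Rightarrow> state \<Rightarrow> bool" where
  "bval (Less e f) s \<longleftrightarrow> aval e s < aval f s"
| "bval (Equal e f) s \<longleftrightarrow> aval e s = aval f s"
| "bval (Not b) s \<longleftrightarrow> \<not> bval b s"
| "bval (And b b') s \<longleftrightarrow> bval b s \<and> bval b' s"

fun acost :: "aexp \<Rightarrow> nat" where
  "acost (Const k) = 1"
| "acost (Var x) = 1"
| "acost (Get a e) = acost e + 1"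
| "acost (Inc e) = acost e + 1"
| "acost (Dec e) = acost e + 1"

fun bcost :: "bexp \<Rightarrow> nat" where
  "bcost (Less e f) = acost e + acost f + 1"
| "bcost (Equal e f) = acost e + acost f + 1"
| "bcost (Not b) = bcost b + 1"
| "bcost (And b b') = bcost b + bcost b' + 1"

text \<open>\<^term>\<open>exec c s T s'\<close>: started in \<^term>\<open>s\<close>, the program \<^term>\<open>c\<close> halts in \<^term>\<open>s'\<close> after T steps.\<close>

inductive exec :: "com \<Rightarrow> state \<Rightarrow> nat \<Rightarrow> state \<Rightarrow> bool" where
  Skip: "exec Skip s 1 s"
| Assign: "exec (Assign x e) s (acost e + 1) ((fst s)(x := aval e s), snd s)"
| Put: "exec (Put a i e) s (acost i + acost e + 1)
          (fst s, (snd s)(a := (snd s a)(aval i s := aval e s)))"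
| Seq: "exec c s T s' \<Longrightarrow> exec c' s' T' s'' \<Longrightarrow> exec (Seq c c') s (T + T') s''"
| IfTrue: "bval b s \<Longrightarrow> exec c s T s' \<Longrightarrow> exec (If b c c') s (bcost b + 1 + T) s'"
| IfFalse: "\<not> bval b s \<Longrightarrow> exec c' s T s' \<Longrightarrow> exec (If b c c') s (bcost b + 1 + T) s'"
| WhileFalse: "\<not> bval b s \<Longrightarrow> exec (While b c) s (bcost b + 1) s"
| WhileTrue: "bval b s \<Longrightarrow> exec c s T s' \<Longrightarrow> exec (While b c) s' T' s'' \<Longrightarrow>
    exec (While b c) s (bcost b + 1 + T + T') s''"

inductive_cases SkipE: "exec Skip s T s'"
inductive_cases AssignE: "exec (Assign x e) s T s'"
inductive_cases PutE: "exec (Put a i e) s T s'"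
inductive_cases SeqE: "exec (Seq c c') s T s'"
inductive_cases IfE: "exec (If b c c') s T s'"
inductive_cases WhileE: "exec (While b c) s T s'"

lemma exec_deterministic:
  "exec c s T s' \<Longrightarrow> exec c s T' s'' \<Longrightarrow> T' = T \<and> s'' = s'"
proof (induction arbitrary: T' s'' rule: exec.induct)
  case (Skip s)
  then show ?case by (rule SkipE) simp
next
  case (Assign x e s)
  then show ?case by (rule AssignE) simp
next
  case (Put a i e s)
  then show ?case by (rule PutE) simp
next
  case (Seq c s T s1 c' T2 s2)
  from Seq.prems show ?case by (rule SeqE) (metis Seq.IH)
next
  case (IfTrue b s c T s1 c')
  from IfTrue.prems show ?case by (rule IfE) (use IfTrue.hyps in \<open>auto dest: IfTrue.IH\<close>)
next
  case (IfFalse b s c' T s1 c)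
  from IfFalse.prems show ?case by (rule IfE) (use IfFalse.hyps in \<open>auto dest: IfFalse.IH\<close>)
next
  case (WhileFalse b s c)
  from WhileFalse.prems show ?case by (rule WhileE) (use WhileFalse.hyps in \<open>auto\<close>)
next
  case (WhileTrue b s c T s1 T2 s2)
  from WhileTrue.prems show ?case proof (rule WhileE)
    fix T3 s3 T4
    assume *: "T' = Suc (bcost b + T3 + T4)" "exec c s T3 s3" "exec (While b c) s3 T4 s''"
    from WhileTrue.IH(1)[OF *(2)] have "T3 = T" "s3 = s1" by simp_all
    with WhileTrue.IH(2)[of T4 s''] * show ?thesis by simp
  qed (use WhileTrue.hyps in simp)
qed

text \<open>
  A graph on the vertices 0, ..., n - 1 is given by adjacency lists, in arbitrary order.  They are
  stored consecutively in the array nbr: the neighbours of v are the entries of nbr at the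
  positions off[v], ..., off[v + 1] - 1.
\<close>

definition adjacency_lists :: "nat list list \<Rightarrow> nat set \<Rightarrow> nat set set \<Rightarrow> bool" where
  "adjacency_lists adj V E \<longleftrightarrow>
     V = {..<length adj} \<and>
     (\<forall>v < length adj. distinct (adj ! v) \<and> set (adj ! v) = nbrs E v)"

definition input_state :: "nat list list \<Rightarrow> state" where
  "input_state adj =
     ((\<lambda>x. if x = ''n'' then length adj else 0),
      (\<lambda>a i. if a = ''off'' \<and> i \<le> length adj then length (concat (take i adj))
             else if a = ''nbr'' \<and> i < length (concat adj) then concat adj ! i
             else 0))"

text \<open>
  The output is a list of k edges without repetitions; the i-th edge joins src[i] and dst[i].
\<close>

definition outputs_edges :: "state \<Rightarrow> nat set set \<Rightarrow> bool" where
  "outputs_edges s M \<longleftrightarrow>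
     M = {{snd s ''src'' i, snd s ''dst'' i} | i. i < fst s ''k''} \<and> card M = fst s ''k''"

text \<open>
  On every graph satisfying P, some edge set M satisfying Q can be computed in time linear in the
  number of vertices and edges, by one program for all these graphs.
\<close>

definition linear_time_edge_search ::
  "(nat set \<Rightarrow> nat set set \<Rightarrow> bool) \<Rightarrow> (nat set \<Rightarrow> nat set set \<Rightarrow> nat set set \<Rightarrow> bool) \<Rightarrow> bool" where
  "linear_time_edge_search P Q \<longleftrightarrow>
     (\<exists>prog C. \<forall>adj V E. simple_graph V E \<and> adjacency_lists adj V E \<and> P V E \<longrightarrow>
        (\<exists>T s M. exec prog (input_state adj) T s \<and> T \<le> C * (card V + card E) \<and>
           outputs_edges s M \<and> Q V E M))"

end

theory Submission imports Defs begin

text \<open>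
  A vertex r of degree at most d is itself one side of a d-cut.  So let r have larger degree, and
  let k = \<Delta> - d, so that (t - 1) k \<le> d + 1.  If every vertex of the ball of radius
  l around r has at most d neighbours outside the ball, let B be this ball.  Otherwise some x at
  distance l from r has at least d + 1 neighbours at distance l + 1.  Were the graph induced by
  these neighbours and x (k - 1)-degenerate, it would contain an independent set of size t, which
  together with x and a shortest path from x to r would induce S_{1^t,l}; so some set B of these
  vertices has minimum degree at least k, and again no vertex of B has more than d neighbours
  outside B.

  Now add to B, as long as possible, vertices with more than d neighbours in B.  As \<Delta> \<le> 2d + 1,
  every addition decreases the number of edges leaving B, which is at most d|B| initially.  The
  process ends with a set of at most (d + 1)|B| < |V| vertices, which is one side of a d-cut.

  This set lies within a distance of r that is bounded in terms of d and l.  As \<Delta> is bounded too,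
  starting from vertex 0 such a set can be found by exhaustive search in constant time.
\<close>

section \<open>Neighbours, balls and spheres\<close>

lemma nbrs_sym: "u \<in> nbrs E v \<longleftrightarrow> v \<in> nbrs E u"
  by (simp add: nbrs_def insert_commute)

primrec ball :: "'a set set \<Rightarrow> 'a set \<Rightarrow> nat \<Rightarrow> 'a set" where
  "ball E A 0 = A"
| "ball E A (Suc i) = ball E A i \<union> (\<Union>v\<in>ball E A i. nbrs E v)"

definition sphere :: "'a set set \<Rightarrow> 'a set \<Rightarrow> nat \<Rightarrow> 'a set" where
  "sphere E A i = ball E A i - (\<Union>m<i. ball E A m)"

lemma ball_mono: "i \<le> j \<Longrightarrow> ball E A i \<subseteq> ball E A j"
  by (rule lift_Suc_mono_le[of "ball E A"]) auto

lemma ball_mono_centre: "A \<subseteq> A' \<Longrightarrow> ball E A i \<subseteq> ball E A' i"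
  by (induction i) auto

lemma ball_ball: "ball E (ball E A i) j = ball E A (i + j)"
  by (induction j) auto

lemma centre_subset_ball: "A \<subseteq> ball E A i"
  using ball_mono[of 0 i E A] by simp

lemma nbr_in_ball_Suc: "v \<in> ball E A i \<Longrightarrow> u \<in> nbrs E v \<Longrightarrow> u \<in> ball E A (Suc i)"
  by auto

lemma sphere_Suc: "sphere E A (Suc i) = ball E A (Suc i) - ball E A i"
proof -
  have "(\<Union>m<Suc i. ball E A m) = ball E A i"
    using ball_mono[of _ i E A] by (fastforce simp: less_Suc_eq_le)
  then show ?thesis by (simp add: sphere_def)
qed

lemma sphere_disjoint: "u \<in> sphere E A i \<Longrightarrow> u \<in> sphere E A j \<Longrightarrow> i = j"
  by (cases i j rule: linorder_cases) (auto simp: sphere_def)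

lemma sphere_nbr_le:
  assumes "u \<in> sphere E A i" "v \<in> sphere E A j" "{u, v} \<in> E"
  shows "j \<le> Suc i"
proof -
  have "v \<in> ball E A (Suc i)"
    using assms nbr_in_ball_Suc[of u E A i v] by (auto simp: sphere_def nbrs_def)
  with assms(2) show ?thesis
    unfolding sphere_def by (meson DiffD2 UN_I lessThan_iff not_le)
qed

lemma sphere_if_nbr_outside:
  assumes "x \<in> ball E A i" "\<not> nbrs E x \<subseteq> ball E A i"
  shows "x \<in> sphere E A i"
proof -
  have "x \<notin> ball E A m" if "m < i" for m
  proof
    assume "x \<in> ball E A m"
    then have "nbrs E x \<subseteq> ball E A (Suc m)" by auto
    also have "\<dots> \<subseteq> ball E A i" using that by (intro ball_mono) simp
    finally show False using assms(2) by simp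
  qed
  with assms(1) show ?thesis by (auto simp: sphere_def)
qed

lemma sphere_predecessor:
  assumes "v \<in> sphere E A (Suc i)"
  obtains u where "u \<in> sphere E A i" "{v, u} \<in> E"
proof -
  from assms obtain u where u: "u \<in> ball E A i" "v \<in> nbrs E u" "v \<notin> ball E A i"
    by (auto simp: sphere_Suc)
  then have "u \<in> sphere E A i" by (intro sphere_if_nbr_outside) auto
  with u(2) show ?thesis by (intro that[of u]) (auto simp: nbrs_def insert_commute)
qed

lemma sphere_geodesic:
  "x \<in> sphere E A i \<Longrightarrow>
    \<exists>p. p 0 = x \<and> (\<forall>m\<le>i. p m \<in> sphere E A (i - m)) \<and> (\<forall>m<i. {p m, p (Suc m)} \<in> E)"
proof (induction i arbitrary: x)
  case 0
  then show ?case by (intro exI[of _ "\<lambda>_. x"]) auto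
next
  case (Suc i)
  from Suc.prems obtain u where u: "u \<in> sphere E A i" "{x, u} \<in> E" by (rule sphere_predecessor)
  from Suc.IH[OF u(1)] obtain p where p: "p 0 = u"
    "\<forall>m\<le>i. p m \<in> sphere E A (i - m)" "\<forall>m<i. {p m, p (Suc m)} \<in> E" by blast
  show ?case
    by (rule exI[of _ "case_nat x p"]) (use p u Suc.prems in \<open>auto split: nat.split\<close>)
qed

locale finite_simple_graph =
  fixes V :: "'a set" and E :: "'a set set"
  assumes simple: "simple_graph V E"
begin

lemma finite_V: "finite V"
  using simple by (simp add: simple_graph_def)

lemma edge_in_V: "{u, v} \<in> E \<Longrightarrow> u \<in> V \<and> v \<in> V \<and> u \<noteq> v"
  using simple by (fastforce simp: simple_graph_def doubleton_eq_iff)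

lemma no_loop [simp]: "{v} \<notin> E"
  using edge_in_V[of v v] by auto

lemma nbrs_subset: "nbrs E v \<subseteq> V"
  using edge_in_V by (auto simp: nbrs_def)

lemma finite_nbrs [simp]: "finite (nbrs E v)"
  using nbrs_subset finite_V by (rule finite_subset)

lemma not_self_nbr [simp]: "v \<notin> nbrs E v"
  by (simp add: nbrs_def)

lemma card_nbrs_split: "card (nbrs E v \<inter> B) + card (nbrs E v - B) = degree E v"
  unfolding degree_def by (rule card_Int_Diff[symmetric]) simp

lemma degree_le_max_degree: "degree E v \<le> max_degree V E"
proof (cases "v \<in> V")
  case True
  then show ?thesis using finite_V by (auto simp: max_degree_def intro!: Max_ge)
next
  case False
  then have "nbrs E v = {}" using edge_in_V by (auto simp: nbrs_def)
  then show ?thesis by (simp add: degree_def)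
qed

lemma max_degree_less_card:
  assumes "V \<noteq> {}"
  shows "max_degree V E < card V"
proof -
  have "degree E v < card V" if "v \<in> V" for v
    unfolding degree_def using that nbrs_subset[of v] finite_V
    by (intro psubset_card_mono psubsetI) auto
  then show ?thesis
    using assms finite_V by (simp add: max_degree_def card_gt_0_iff)
qed

lemma ball_subset: "A \<subseteq> V \<Longrightarrow> ball E A i \<subseteq> V"
  by (induction i) (use nbrs_subset in auto)

lemma finite_ball: "A \<subseteq> V \<Longrightarrow> finite (ball E A i)"
  using ball_subset finite_V by (rule finite_subset)

lemma sphere_subset: "A \<subseteq> V \<Longrightarrow> sphere E A i \<subseteq> V"
  using ball_subset[of A i] by (auto simp: sphere_def)

lemma card_nbrs_next_sphere:
  assumes "u \<in> sphere E A (Suc i)"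
  shows "card (nbrs E u \<inter> sphere E A (Suc (Suc i))) \<le> max_degree V E - 1"
proof -
  obtain w where w: "w \<in> sphere E A i" "{u, w} \<in> E" using assms by (rule sphere_predecessor)
  have "w \<notin> sphere E A (Suc (Suc i))"
    using sphere_disjoint[OF w(1), of "Suc (Suc i)"] by auto
  then have "card (nbrs E u \<inter> sphere E A (Suc (Suc i))) \<le> card (nbrs E u - {w})"
    by (intro card_mono) auto
  also have "\<dots> = degree E u - 1" using w(2) by (simp add: nbrs_def degree_def)
  finally show ?thesis using degree_le_max_degree[of u] by linarith
qed

lemma card_sphere_Suc_Suc:
  assumes "A \<subseteq> V"
  shows "card (sphere E A (Suc (Suc i))) \<le> card (sphere E A (Suc i)) * (max_degree V E - 1)"
proof -
  let ?S = "sphere E A (Suc i)" and ?S' = "sphere E A (Suc (Suc i))"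
  have finite_S: "finite ?S" using sphere_subset[OF assms] finite_V by (rule finite_subset)
  have covered: "?S' \<subseteq> (\<Union>u\<in>?S. nbrs E u \<inter> ?S')"
  proof
    fix v assume v: "v \<in> ?S'"
    then obtain u where "u \<in> ?S" "{v, u} \<in> E" by (rule sphere_predecessor)
    with v show "v \<in> (\<Union>u\<in>?S. nbrs E u \<inter> ?S')" by (auto simp: nbrs_def insert_commute)
  qed
  have "card ?S' \<le> card (\<Union>u\<in>?S. nbrs E u \<inter> ?S')"
    by (rule card_mono[OF _ covered]) (use finite_S in auto)
  also have "\<dots> \<le> (\<Sum>u\<in>?S. card (nbrs E u \<inter> ?S'))" by (rule card_UN_le[OF finite_S])
  also have "\<dots> \<le> card ?S * (max_degree V E - 1)"
    using sum_bounded_above[of ?S "\<lambda>u. card (nbrs E u \<inter> ?S')" "max_degree V E - 1"]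
      card_nbrs_next_sphere by simp
  finally show ?thesis .
qed

lemma card_sphere:
  assumes "r \<in> V"
  shows "card (sphere E {r} (Suc i)) \<le> max_degree V E * (max_degree V E - 1) ^ i"
proof (induction i)
  case 0
  have "card (sphere E {r} (Suc 0)) \<le> degree E r"
    unfolding degree_def by (intro card_mono) (auto simp: sphere_Suc)
  then show ?case using degree_le_max_degree[of r] by simp
next
  case (Suc i)
  have "card (sphere E {r} (Suc (Suc i))) \<le> card (sphere E {r} (Suc i)) * (max_degree V E - 1)"
    using assms by (intro card_sphere_Suc_Suc) simp
  also have "\<dots> \<le> max_degree V E * (max_degree V E - 1) ^ i * (max_degree V E - 1)"
    using Suc.IH by (rule mult_right_mono) simp
  finally show ?case by (simp add: mult_ac)
qed

lemma card_ball:
  assumes "r \<in> V" "max_degree V E \<ge> 2"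
  shows "(max_degree V E - 2) * card (ball E {r} i) + 2 \<le> max_degree V E * (max_degree V E - 1) ^ i"
proof -
  obtain m where degree_eq: "max_degree V E = m + 2"
    using assms(2) by (metis add.commute le_iff_add)
  have "m * card (ball E {r} i) + 2 \<le> (m + 2) * (m + 1) ^ i"
  proof (induction i)
    case (Suc i)
    have "ball E {r} (Suc i) = ball E {r} i \<union> sphere E {r} (Suc i)" by (auto simp: sphere_Suc)
    then have "card (ball E {r} (Suc i)) \<le> card (ball E {r} i) + card (sphere E {r} (Suc i))"
      by (metis card_Un_le)
    also have "\<dots> \<le> card (ball E {r} i) + (m + 2) * (m + 1) ^ i"
      using card_sphere[OF assms(1), of i] degree_eq by simp
    finally have "m * card (ball E {r} (Suc i)) \<le>
        m * (card (ball E {r} i) + (m + 2) * (m + 1) ^ i)"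
      by (rule mult_left_mono) simp
    with Suc.IH show ?case by (simp add: algebra_simps)
  qed simp
  then show ?thesis by (simp add: degree_eq)
qed

end


section \<open>Induced copies of $S_{1^t,\ell}$\<close>

definition independent :: "'a set set \<Rightarrow> 'a set \<Rightarrow> bool" where
  "independent E I \<longleftrightarrow> (\<forall>u\<in>I. \<forall>v\<in>I. {u, v} \<notin> E)"

definition induced_path :: "'a set set \<Rightarrow> (nat \<Rightarrow> 'a) \<Rightarrow> nat \<Rightarrow> bool" where
  "induced_path E p l \<longleftrightarrow>
     (\<forall>i j. i < j \<and> j \<le> l \<longrightarrow> p i \<noteq> p j \<and> ({p i, p j} \<in> E \<longleftrightarrow> j = Suc i))"

definition pendant_leaves :: "'a set set \<Rightarrow> (nat \<Rightarrow> 'a) \<Rightarrow> nat \<Rightarrow> 'a set \<Rightarrow> bool" where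
  "pendant_leaves E p l I \<longleftrightarrow> independent E I \<and> I \<subseteq> nbrs E (p 0) \<and> I \<inter> p ` {..l} = {} \<and>
     (\<forall>u\<in>I. \<forall>m\<in>{1..l}. {u, p m} \<notin> E)"

definition S_embedding :: "nat \<Rightarrow> (nat \<Rightarrow> 'a) \<Rightarrow> (nat \<Rightarrow> 'a) \<Rightarrow> nat \<Rightarrow> 'a" where
  "S_embedding t p leaf n = (if n = 0 then p 0 else if n \<le> t then leaf n else p (n - t))"

lemma S_edges_iff:
  assumes "i < j" "j \<le> t + l"
  shows "{i, j} \<in> S_edges t l \<longleftrightarrow> i = 0 \<and> j \<le> t + 1 \<or> t + 1 \<le> i \<and> j = Suc i"
  using assms by (auto simp: S_edges_def doubleton_eq_iff)

lemma S_edges_no_loop: "{i} \<notin> S_edges t l"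
  by (auto simp: S_edges_def doubleton_eq_iff)

lemma induced_path_distinct: "induced_path E p l \<Longrightarrow> i < j \<Longrightarrow> j \<le> l \<Longrightarrow> p i \<noteq> p j"
  and induced_path_edge_iff:
    "induced_path E p l \<Longrightarrow> i < j \<Longrightarrow> j \<le> l \<Longrightarrow> {p i, p j} \<in> E \<longleftrightarrow> j = Suc i"
  by (simp_all add: induced_path_def)

lemma induced_path_if_geodesic:
  assumes dist: "\<And>m. m \<le> l \<Longrightarrow> p m \<in> sphere E A (l - m)"
    and edge: "\<And>m. m < l \<Longrightarrow> {p m, p (Suc m)} \<in> E"
  shows "induced_path E p l"
  unfolding induced_path_def
proof (intro allI impI conjI)
  fix i j assume ij: "i < j \<and> j \<le> l"
  then show "p i \<noteq> p j"
    using sphere_disjoint[OF dist[of i], of "l - j"] dist[of j] by auto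
  show "{p i, p j} \<in> E \<longleftrightarrow> j = Suc i"
  proof
    assume "{p i, p j} \<in> E"
    then have "l - i \<le> Suc (l - j)"
      using ij sphere_nbr_le[OF dist[of j] dist[of i]] by (simp add: insert_commute)
    with ij show "j = Suc i" by linarith
  qed (use ij edge in simp)
qed

context finite_simple_graph
begin

lemma not_free_if_induced_copy:
  fixes g :: "'b::linorder \<Rightarrow> 'a"
  assumes "g ` VH \<subseteq> V" "\<And>i. {i} \<notin> EH"
    and distinct: "\<And>i j. i \<in> VH \<Longrightarrow> j \<in> VH \<Longrightarrow> i < j \<Longrightarrow> g i \<noteq> g j"
    and adjacent: "\<And>i j. i \<in> VH \<Longrightarrow> j \<in> VH \<Longrightarrow> i < j \<Longrightarrow> {g i, g j} \<in> E \<longleftrightarrow> {i, j} \<in> EH"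
  shows "\<not> is_free VH EH V E"
proof -
  define f where "f = the_inv_into VH g"
  have inj: "inj_on g VH" by (rule linorder_inj_onI) (use distinct in auto)
  then have f_g: "f (g i) = i" if "i \<in> VH" for i
    unfolding f_def using that by (rule the_inv_into_f_f)
  have "{g i, g j} \<in> E \<longleftrightarrow> {i, j} \<in> EH" if "i \<in> VH" "j \<in> VH" for i j
    using that adjacent[of i j] adjacent[of j i] assms(2)
    by (cases i j rule: linorder_cases) (auto simp: insert_commute)
  then have "\<forall>u\<in>g ` VH. \<forall>v\<in>g ` VH. {u, v} \<in> induced_edges E (g ` VH) \<longleftrightarrow> {f u, f v} \<in> EH"
    using f_g by (simp add: induced_edges_def)
  moreover have "bij_betw f (g ` VH) VH"
    unfolding f_def using inj by (intro bij_betw_the_inv_into) (simp add: bij_betw_def)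
  ultimately have "graph_iso (g ` VH) (induced_edges E (g ` VH)) VH EH"
    unfolding graph_iso_def by blast
  with assms(1) show ?thesis unfolding is_free_def by blast
qed

lemma S_embedding_induced:
  assumes "induced_path E p l" and pendant: "pendant_leaves E p l I"
    and leaf: "bij_betw leaf {1..t} I" and ij: "i < j" "j \<le> t + l"
  defines "g \<equiv> S_embedding t p leaf"
  shows "g i \<noteq> g j \<and> ({g i, g j} \<in> E \<longleftrightarrow> {i, j} \<in> S_edges t l)"
proof -
  have leaf_in: "leaf n \<in> I" if "1 \<le> n" "n \<le> t" for n
    using that leaf by (auto simp: bij_betw_def)
  consider (centre_leaf) "i = 0" "j \<le> t" | (leaves) "1 \<le> i" "j \<le> t"
    | (leaf_path) "1 \<le> i" "i \<le> t" "t < j" | (path) "i = 0 \<or> t < i" "t < j"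
    using ij(1) by linarith
  then show ?thesis
  proof cases
    case centre_leaf
    with ij leaf_in[of j] pendant have "{p 0, leaf j} \<in> E"
      by (auto simp: pendant_leaves_def nbrs_def)
    with centre_leaf ij edge_in_V[of "p 0" "leaf j"] show ?thesis
      by (simp add: g_def S_embedding_def S_edges_iff)
  next
    case leaves
    then have "leaf i \<noteq> leaf j"
      using ij inj_onD[OF bij_betw_imp_inj_on[OF leaf], of i j] by auto
    moreover have "{leaf i, leaf j} \<notin> E"
      using pendant leaf_in leaves ij by (simp add: pendant_leaves_def independent_def)
    ultimately show ?thesis using leaves ij by (simp add: g_def S_embedding_def S_edges_iff)
  next
    case leaf_path
    then have "1 \<le> j - t" "j - t \<le> l" using ij by linarith+
    then have "leaf i \<noteq> p (j - t)" "{leaf i, p (j - t)} \<notin> E"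
      using pendant leaf_in[of i] leaf_path by (auto simp: pendant_leaves_def)
    then show ?thesis using leaf_path ij by (simp add: g_def S_embedding_def S_edges_iff)
  next
    case path
    then have path_indices: "i - t < j - t" "j - t \<le> l" using ij by linarith+
    have "{p (i - t), p (j - t)} \<in> E \<longleftrightarrow> i = 0 \<and> j = t + 1 \<or> t < i \<and> j = Suc i"
      using induced_path_edge_iff[OF assms(1) path_indices] path ij by auto
    moreover have "g i = p (i - t)" "g j = p (j - t)"
      using path by (auto simp: g_def S_embedding_def)
    ultimately show ?thesis
      using path ij induced_path_distinct[OF assms(1) path_indices] by (auto simp: S_edges_iff)
  qed
qed

lemma not_free_if_pendant_leaves:
  assumes path: "induced_path E p l" "p ` {..l} \<subseteq> V"
    and leaves: "pendant_leaves E p l I" "card I = t"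
  shows "\<not> is_free (S_verts t l) (S_edges t l) V E"
proof -
  have I: "I \<subseteq> nbrs E (p 0)" using leaves(1) by (simp add: pendant_leaves_def)
  then have "finite I" using finite_nbrs by (rule finite_subset)
  then obtain leaf where leaf: "bij_betw leaf {1..t} I"
    using leaves(2) ex_bij_betw_nat_finite_1[of I] by auto
  have "S_embedding t p leaf i \<in> V" if "i \<in> S_verts t l" for i
  proof -
    have "leaf i \<in> I" if "1 \<le> i" "i \<le> t" using that leaf by (auto simp: bij_betw_def)
    with that path(2) I nbrs_subset show ?thesis
      by (fastforce simp: S_embedding_def S_verts_def)
  qed
  then show ?thesis
    using S_embedding_induced[OF path(1) leaves(1) leaf] S_edges_no_loop
    by (intro not_free_if_induced_copy[of "S_embedding t p leaf"]) (auto simp: S_verts_def)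
qed

lemma not_free_if_independent_nbrs_in_next_sphere:
  assumes r: "r \<in> V" and x: "x \<in> sphere E {r} l"
    and I: "I \<subseteq> nbrs E x \<inter> sphere E {r} (Suc l)" "card I = t" "independent E I"
  shows "\<not> is_free (S_verts t l) (S_edges t l) V E"
proof -
  from sphere_geodesic[OF x] obtain p where p: "p 0 = x"
    "\<And>m. m \<le> l \<Longrightarrow> p m \<in> sphere E {r} (l - m)" "\<And>m. m < l \<Longrightarrow> {p m, p (Suc m)} \<in> E" by blast
  have "induced_path E p l" using p(2,3) by (rule induced_path_if_geodesic)
  moreover have "p ` {..l} \<subseteq> V" using p(2) sphere_subset[of "{r}"] r by fastforce
  moreover have "pendant_leaves E p l I"
    unfolding pendant_leaves_def
  proof (intro conjI ballI)
    show "I \<inter> p ` {..l} = {}"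
      using I(1) p(2) sphere_disjoint[of _ E "{r}" "Suc l"] by fastforce
    show "{u, p m} \<notin> E" if "u \<in> I" "m \<in> {1..l}" for u m
      using that I(1) sphere_nbr_le[OF p(2), of m u "Suc l"] by (auto simp: insert_commute)
  qed (use I p(1) in auto)
  ultimately show ?thesis using I(2) by (rule not_free_if_pendant_leaves)
qed

lemma independent_insert:
  assumes "independent E I" "I \<inter> nbrs E b = {}"
  shows "independent E (insert b I)"
  using assms by (auto simp: independent_def nbrs_def insert_commute)

text \<open>Choosing vertices greedily yields a large independent set, unless the choice gets stuck in a
  set of large minimum degree.\<close>

lemma independent_or_dense_subset:
  assumes "finite W" "t * k < card W + k"
  shows "(\<exists>I\<subseteq>W. card I = t \<and> independent E I) \<or>
    (\<exists>B\<subseteq>W. B \<noteq> {} \<and> (\<forall>b\<in>B. k \<le> card (nbrs E b \<inter> B)))"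
  using assms
proof (induction t arbitrary: W)
  case 0
  then show ?case by (intro disjI1 exI[of _ "{}"]) (auto simp: independent_def)
next
  case (Suc t)
  show ?case
  proof (cases "\<forall>b\<in>W. k \<le> card (nbrs E b \<inter> W)")
    case True
    moreover have "W \<noteq> {}" using Suc.prems by auto
    ultimately show ?thesis by blast
  next
    case False
    then obtain b where b: "b \<in> W" "card (nbrs E b \<inter> W) < k" by auto
    define W' where "W' = W - insert b (nbrs E b \<inter> W)"
    have W': "W' \<subseteq> W" "finite W'" using Suc.prems(1) by (auto simp: W'_def)
    have "card W' = card W - card (insert b (nbrs E b \<inter> W))"
      unfolding W'_def using b Suc.prems by (intro card_Diff_subset) auto
    moreover have "card (insert b (nbrs E b \<inter> W)) \<le> k" using b by simp
    ultimately have "t * k < card W' + k" using Suc.prems by auto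
    from Suc.IH[OF W'(2) this] consider
      (independent) I where "I \<subseteq> W'" "card I = t" "independent E I"
      | (dense) B where "B \<subseteq> W'" "B \<noteq> {}" "\<forall>b\<in>B. k \<le> card (nbrs E b \<inter> B)" by blast
    then show ?thesis
    proof cases
      case independent
      have "finite I" using independent(1) W'(2) by (rule finite_subset)
      moreover have "b \<notin> I" using independent(1) by (auto simp: W'_def)
      ultimately have "card (insert b I) = Suc t" using independent(2) by simp
      moreover have "independent E (insert b I)"
        using independent(3,1) by (intro independent_insert) (auto simp: W'_def)
      ultimately show ?thesis
        using independent(1) b(1) W'(1) by (intro disjI1 exI[of _ "insert b I"]) auto
    next
      case dense
      with W'(1) show ?thesis by (intro disjI2 exI[of _ B]) auto
    qed
  qed
qed

end


section \<open>Boundaries of vertex sets\<close>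

definition sparse_boundary :: "'a set set \<Rightarrow> nat \<Rightarrow> 'a set \<Rightarrow> bool" where
  "sparse_boundary E d B \<longleftrightarrow> (\<forall>b\<in>B. card (nbrs E b - B) \<le> d)"

definition boundary_size :: "'a set set \<Rightarrow> 'a set \<Rightarrow> nat" where
  "boundary_size E B = (\<Sum>b\<in>B. card (nbrs E b - B))"

definition cut_edges :: "'a set \<Rightarrow> 'a set set \<Rightarrow> 'a set \<Rightarrow> 'a set set" where
  "cut_edges V E B = {e \<in> E. \<exists>b\<in>B. \<exists>u\<in>V - B. e = {b, u}}"

definition cut_side :: "nat \<Rightarrow> 'a set \<Rightarrow> 'a set set \<Rightarrow> 'a set \<Rightarrow> bool" where
  "cut_side d V E B \<longleftrightarrow>
     B \<noteq> {} \<and> B \<subset> V \<and> sparse_boundary E d B \<and> sparse_boundary E d (V - B)"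

lemma boundary_size_le: "sparse_boundary E d B \<Longrightarrow> boundary_size E B \<le> d * card B"
  using sum_bounded_above[of B "\<lambda>b. card (nbrs E b - B)" d]
  by (simp add: sparse_boundary_def boundary_size_def mult.commute)

context finite_simple_graph
begin

lemma nbrs_diff_complement: "nbrs E v - (V - B) = nbrs E v \<inter> B"
  using nbrs_subset[of v] by auto

lemma d_cut_if_cut_side:
  assumes "cut_side d V E B"
  shows "d_cut d V E (cut_edges V E B)"
proof -
  have "nbrs E b \<inter> (V - B) = nbrs E b - B" for b using nbrs_subset[of b] by auto
  with assms show ?thesis
    unfolding d_cut_def cut_side_def sparse_boundary_def cut_edges_def nbrs_diff_complement
    by (intro conjI exI[of _ B] exI[of _ "V - B"]) auto
qed

lemma cut_edges_eq_image: "cut_edges V E B = (\<lambda>(b, u). {b, u}) ` (SIGMA b:B. nbrs E b - B)"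
  using edge_in_V by (force simp: cut_edges_def nbrs_def)

lemma card_cut_edges:
  assumes "finite B"
  shows "card (cut_edges V E B) = boundary_size E B"
proof -
  have "inj_on (\<lambda>(b, u). {b, u}) (SIGMA b:B. nbrs E b - B)"
    by (auto simp: inj_on_def doubleton_eq_iff)
  with assms show ?thesis
    by (simp add: cut_edges_eq_image card_image boundary_size_def)
qed

lemma cut_side_singleton:
  assumes "r \<in> V" "degree E r \<le> d" "1 \<le> d" "1 \<le> max_degree V E"
  shows "cut_side d V E {r}"
proof -
  have "1 < card V" using max_degree_less_card assms(1,4) by fastforce
  then have "{r} \<subset> V" using assms(1) by auto
  moreover have "card (nbrs E u \<inter> {r}) \<le> d" for u
    using card_mono[of "{r}" "nbrs E u \<inter> {r}"] assms(3) by auto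
  ultimately show ?thesis
    using assms(2) by (simp add: cut_side_def sparse_boundary_def nbrs_diff_complement degree_def)
qed

lemma sparse_boundary_if_dense:
  assumes "\<forall>b\<in>B. max_degree V E - d \<le> card (nbrs E b \<inter> B)"
  shows "sparse_boundary E d B"
  unfolding sparse_boundary_def
proof
  fix b assume "b \<in> B"
  with assms card_nbrs_split[of b B] degree_le_max_degree[of b]
  show "card (nbrs E b - B) \<le> d" by fastforce
qed

lemma sparse_boundary_in_neighbourhood:
  assumes N: "N \<subseteq> nbrs E x" "d < card N" and t: "t \<ge> 2"
    and deg: "(t - 1) * max_degree V E \<le> t * d + 1"
    and no_independent: "\<And>I. I \<subseteq> N \<Longrightarrow> card I = t \<Longrightarrow> \<not> independent E I"
  obtains B where "B \<subseteq> insert x N" "B \<noteq> {}" "sparse_boundary E d B"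
proof -
  define k where "k = max_degree V E - d"
  obtain s where t_eq: "t = Suc s" using t by (cases t) auto
  then have "s * k \<le> d + 1" using deg by (simp add: k_def diff_mult_distrib2)
  then have "t * k \<le> d + 1 + k" using t_eq by simp
  moreover have "finite N" using N(1) finite_nbrs by (rule finite_subset)
  moreover have "x \<notin> N" using N(1) by auto
  ultimately have large: "t * k < card (insert x N) + k" using N(2) by simp
  have "\<not> independent E I" if I: "I \<subseteq> insert x N" "card I = t" for I
  proof
    assume independent: "independent E I"
    have "x \<notin> I"
    proof
      assume "x \<in> I"
      then have "I \<subseteq> {x}" using I(1) N(1) independent by (auto simp: independent_def nbrs_def)
      then have "card I \<le> 1" using card_mono[of "{x}" I] by simp
      with I(2) t show False by simp
    qed
    with I(1) have "I \<subseteq> N" by auto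
    then show False using I(2) independent no_independent by blast
  qed
  with independent_or_dense_subset[OF _ large] \<open>finite N\<close> obtain B where
    "B \<subseteq> insert x N" "B \<noteq> {}" "\<forall>b\<in>B. k \<le> card (nbrs E b \<inter> B)" by blast
  then show ?thesis using that sparse_boundary_if_dense unfolding k_def by blast
qed

lemma sparse_boundary_in_ball:
  assumes free: "is_free (S_verts t l) (S_edges t l) V E" and t: "t \<ge> 2"
    and deg: "(t - 1) * max_degree V E \<le> t * d + 1" and r: "r \<in> V"
  obtains B where "B \<subseteq> ball E {r} (Suc l)" "B \<noteq> {}" "sparse_boundary E d B"
proof (cases "sparse_boundary E d (ball E {r} l)")
  case True
  then show ?thesis
    using that[of "ball E {r} l"] ball_mono[of l "Suc l" E "{r}"] centre_subset_ball[of "{r}" E l]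
    by auto
next
  case False
  then obtain x where x: "x \<in> ball E {r} l" "d < card (nbrs E x - ball E {r} l)"
    by (auto simp: sparse_boundary_def)
  then have "\<not> nbrs E x \<subseteq> ball E {r} l" by (metis Diff_eq_empty_iff card.empty not_less_zero)
  with x(1) have sphere: "x \<in> sphere E {r} l" by (rule sphere_if_nbr_outside)
  have "nbrs E x - ball E {r} l \<subseteq> nbrs E x \<inter> sphere E {r} (Suc l)"
    using x(1) by (auto simp: sphere_Suc)
  then have "\<not> independent E I" if "I \<subseteq> nbrs E x - ball E {r} l" "card I = t" for I
    using not_free_if_independent_nbrs_in_next_sphere[OF r sphere _ that(2)] that(1) free by blast
  from sparse_boundary_in_neighbourhood[OF Diff_subset x(2) t deg this]
  obtain B where B: "B \<subseteq> insert x (nbrs E x - ball E {r} l)" "B \<noteq> {}" "sparse_boundary E d B" .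
  have "B \<subseteq> ball E {r} (Suc l)" using B(1) x(1) by auto
  then show ?thesis using B(2,3) by (rule that)
qed

lemma card_nbrs_diff_insert:
  assumes "u \<notin> B"
  shows "card (nbrs E b - insert u B) + of_bool (b \<in> nbrs E u) = card (nbrs E b - B)"
proof (cases "b \<in> nbrs E u")
  case True
  then have "nbrs E b - B = insert u (nbrs E b - insert u B)"
    using assms nbrs_sym[of u E b] by auto
  then have "card (nbrs E b - B) = Suc (card (nbrs E b - insert u B))"
    by (metis card_insert_disjoint finite_Diff finite_nbrs DiffD2 insertI1)
  with True show ?thesis by simp
next
  case False
  then have "nbrs E b - insert u B = nbrs E b - B" using nbrs_sym[of u E b] by auto
  with False show ?thesis by simp
qed

lemma sparse_boundary_insert:
  assumes "sparse_boundary E d B" "u \<notin> B" "card (nbrs E u - B) \<le> d"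
  shows "sparse_boundary E d (insert u B)"
  unfolding sparse_boundary_def
proof
  fix b assume "b \<in> insert u B"
  then have "card (nbrs E b - B) \<le> d" using assms by (auto simp: sparse_boundary_def)
  with card_nbrs_diff_insert[OF assms(2), of b]
  show "card (nbrs E b - insert u B) \<le> d" by linarith
qed

lemma boundary_size_insert:
  assumes "finite B" "u \<notin> B"
  shows "boundary_size E (insert u B) + card (nbrs E u \<inter> B) =
    boundary_size E B + card (nbrs E u - B)"
proof -
  have "boundary_size E B =
      (\<Sum>b\<in>B. card (nbrs E b - insert u B)) + (\<Sum>b\<in>B. of_bool (b \<in> nbrs E u))"
    using card_nbrs_diff_insert[OF assms(2)]
    by (simp add: boundary_size_def sum.distrib[symmetric])
  moreover have "(\<Sum>b\<in>B. of_bool (b \<in> nbrs E u)) = card (nbrs E u \<inter> B)"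
    using assms(1) by (simp add: sum_of_bool_eq Int_commute)
  moreover have "nbrs E u - insert u B = nbrs E u - B" by auto
  ultimately show ?thesis using assms by (simp add: boundary_size_def)
qed

lemma cut_closure:
  assumes deg: "max_degree V E \<le> 2 * d + 1" and "B \<subseteq> V" "sparse_boundary E d B"
  shows "\<exists>B'. B \<subseteq> B' \<and> B' \<subseteq> ball E B (boundary_size E B) \<and>
    card B' \<le> card B + boundary_size E B \<and> sparse_boundary E d B' \<and> sparse_boundary E d (V - B')"
  using assms(2,3)
proof (induction "boundary_size E B" arbitrary: B rule: less_induct)
  case less
  show ?case
  proof (cases "sparse_boundary E d (V - B)")
    case True
    with less.prems show ?thesis
      using centre_subset_ball[of B E] by (intro exI[of _ B]) auto
  next
    case False
    then obtain u where u: "u \<in> V" "u \<notin> B" "d < card (nbrs E u \<inter> B)"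
      by (auto simp: sparse_boundary_def nbrs_diff_complement)
    define C where "C = insert u B"
    have "finite B" using less.prems(1) finite_V by (rule finite_subset)
    then have card_C: "card C = Suc (card B)" using u(2) by (simp add: C_def)
    have out: "card (nbrs E u - B) \<le> d"
      using u(3) card_nbrs_split[of u B] degree_le_max_degree[of u] deg by linarith
    then have smaller: "boundary_size E C < boundary_size E B"
      using boundary_size_insert[OF \<open>finite B\<close> u(2)] u(3) by (simp add: C_def)
    have "C \<subseteq> V" using less.prems(1) u(1) by (simp add: C_def)
    moreover have "sparse_boundary E d C"
      unfolding C_def using less.prems(2) u(2) out by (rule sparse_boundary_insert)
    ultimately obtain B' where B': "C \<subseteq> B'" "B' \<subseteq> ball E C (boundary_size E C)"
      "card B' \<le> card C + boundary_size E C" "sparse_boundary E d B'" "sparse_boundary E d (V - B')"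
      using less.hyps[OF smaller] by blast
    have "nbrs E u \<inter> B \<noteq> {}" using u(3) by auto
    then have "C \<subseteq> ball E B 1" using nbrs_sym[of u E] by (auto simp: C_def)
    then have "ball E C (boundary_size E C) \<subseteq> ball E B (1 + boundary_size E C)"
      using ball_mono_centre ball_ball by metis
    also have "\<dots> \<subseteq> ball E B (boundary_size E B)" using smaller by (intro ball_mono) simp
    finally show ?thesis
      using B' card_C smaller by (intro exI[of _ B']) (auto simp: C_def)
  qed
qed

lemma cut_side_near_sparse_boundary:
  assumes "max_degree V E \<le> 2 * d + 1" "B \<subseteq> V" "B \<noteq> {}" "sparse_boundary E d B"
    and small: "(d + 1) * card B < card V"
  obtains B' where "B' \<subseteq> ball E B (d * card B)" "cut_side d V E B'"
proof -
  obtain B' where B': "B \<subseteq> B'" "B' \<subseteq> ball E B (boundary_size E B)"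
    "card B' \<le> card B + boundary_size E B" "sparse_boundary E d B'" "sparse_boundary E d (V - B')"
    using cut_closure[OF assms(1,2,4)] by blast
  have boundary: "boundary_size E B \<le> d * card B" using assms(4) by (rule boundary_size_le)
  then have "card B' < card V" using B'(3) small by simp
  moreover have "B' \<subseteq> V" using B'(2) ball_subset[OF assms(2)] by (rule subset_trans)
  ultimately have "cut_side d V E B'" using B' assms(3) by (auto simp: cut_side_def)
  moreover have "B' \<subseteq> ball E B (d * card B)"
    using B'(2) ball_mono[OF boundary] by (rule subset_trans)
  ultimately show ?thesis using that by blast
qed

end


section \<open>Cuts near a given vertex\<close>

definition cut_radius :: "nat \<Rightarrow> nat \<Rightarrow> nat" where
  "cut_radius d l = Suc l + d * (2 * d + 1) ^ (l + 2)"

lemma degree_bound_le: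
  fixes D d t :: nat
  assumes "(t - 1) * D \<le> t * d + 1" "t \<ge> 2"
  shows "D \<le> 2 * d + 1"
proof (rule ccontr)
  obtain s where t_eq: "t = s + 2" using assms(2) by (metis add.commute le_iff_add)
  assume "\<not> ?thesis"
  then have "(s + 1) * (2 * d + 2) \<le> (s + 1) * D" by (intro mult_left_mono) auto
  also have "\<dots> \<le> (s + 2) * d + 1" using assms(1) t_eq by simp
  finally show False by (simp add: algebra_simps)
qed

lemma (in finite_simple_graph) cut_side_in_ball:
  assumes free: "is_free (S_verts t l) (S_edges t l) V E" and t: "t \<ge> 2" and r: "r \<in> V"
    and deg3: "max_degree V E \<ge> 3" and deg: "(t - 1) * max_degree V E \<le> t * d + 1"
    and large: "(d + 1) * (max_degree V E * (max_degree V E - 1) ^ (l + 1) - 2)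
      < (max_degree V E - 2) * card V"
  obtains B where "B \<subseteq> ball E {r} (cut_radius d l)" "cut_side d V E B"
proof -
  let ?D = "max_degree V E"
  have D: "?D \<le> 2 * d + 1" using deg t by (rule degree_bound_le)
  obtain B where B: "B \<subseteq> ball E {r} (Suc l)" "B \<noteq> {}" "sparse_boundary E d B"
    using free t deg r by (rule sparse_boundary_in_ball)
  have "card B \<le> card (ball E {r} (Suc l))" using B(1) r by (intro card_mono finite_ball) auto
  then have "(?D - 2) * card B \<le> (?D - 2) * card (ball E {r} (Suc l))" by (rule mult_le_mono2)
  then have card_B: "(?D - 2) * card B + 2 \<le> ?D * (?D - 1) ^ (l + 1)"
    using card_ball[OF r, of "Suc l"] deg3 unfolding Suc_eq_plus1 by linarith
  have "(?D - 2) * ((d + 1) * card B) = (d + 1) * ((?D - 2) * card B)" by (rule mult.left_commute)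
  also have "\<dots> \<le> (d + 1) * (?D * (?D - 1) ^ (l + 1) - 2)"
    using card_B by (intro mult_left_mono) auto
  also note large
  finally have "(d + 1) * card B < card V" by simp
  moreover have "B \<subseteq> V" using B(1) ball_subset[of "{r}" "Suc l"] r by auto
  ultimately obtain B' where B': "B' \<subseteq> ball E B (d * card B)" "cut_side d V E B'"
    using cut_side_near_sparse_boundary[OF D _ B(2,3)] by blast
  have "1 * card B \<le> (?D - 2) * card B" using deg3 by (intro mult_right_mono) auto
  also have "\<dots> \<le> ?D * (?D - 1) ^ (l + 1)" using card_B by simp
  also have "\<dots> \<le> (2 * d + 1) * (2 * d + 1) ^ (l + 1)"
    using D by (intro mult_mono power_mono) auto
  finally have "card B \<le> (2 * d + 1) ^ (l + 2)" by simp
  then have radius: "Suc l + d * card B \<le> cut_radius d l"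
    unfolding cut_radius_def by (intro add_left_mono mult_left_mono) auto
  have "B' \<subseteq> ball E {r} (Suc l + d * card B)"
    using B'(1) ball_mono_centre[OF B(1), of E "d * card B"] unfolding ball_ball by blast
  also have "\<dots> \<subseteq> ball E {r} (cut_radius d l)" using radius by (rule ball_mono)
  finally show ?thesis using B'(2) by (rule that)
qed

lemma admissible_cases:
  assumes adm: "admissible d t l V E" and "t \<ge> 2"
  obtains (degree_two) "max_degree V E = 2"
  | (large) "max_degree V E \<ge> 3" "(t - 1) * max_degree V E \<le> t * d + 1"
    "(d + 1) * (max_degree V E * (max_degree V E - 1) ^ (l + 1) - 2)
      < (max_degree V E - 2) * card V"
proof (cases "max_degree V E = 2")
  case False
  define D where "D = max_degree V E"
  have D: "D \<ge> 3" and deg: "real D \<le> real t / (real t - 1) * real d + 1 / (real t - 1)"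
    and large: "real (card V) >
      (real d + 1) * ((real D * (real D - 1) ^ (l + 1) - 2) / (real D - 2))"
    using adm False by (auto simp: admissible_def Let_def D_def)
  have "(real t - 1) * real D \<le> real t * real d + 1"
    using deg assms(2) by (simp add: field_simps)
  then have "real ((t - 1) * D) \<le> real (t * d + 1)" using assms(2) by simp
  then have deg_nat: "(t - 1) * D \<le> t * d + 1" by (simp only: of_nat_le_iff)
  define X where "X = D * (D - 1) ^ (l + 1)"
  have real_X: "real X = real D * (real D - 1) ^ (l + 1)" using D by (simp add: X_def of_nat_diff)
  have "D * 1 \<le> X" unfolding X_def using D by (intro mult_left_mono) auto
  then have "real (X - 2) = real X - 2" using D by (simp add: of_nat_diff)
  then have "real ((d + 1) * (X - 2)) = (real d + 1) * (real X - 2)"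
    by (simp only: of_nat_mult of_nat_add of_nat_1)
  also have "\<dots> < (real D - 2) * real (card V)"
    using large D unfolding real_X[symmetric] by (simp add: field_simps)
  also have "\<dots> = real ((D - 2) * card V)" using D by (simp add: of_nat_diff)
  finally have "(d + 1) * (X - 2) < (D - 2) * card V" by (simp only: of_nat_less_iff)
  with that(2) D deg_nat show ?thesis unfolding X_def D_def by blast
qed (rule that(1))

lemma admissible_max_degree:
  assumes "admissible d t l V E" "d \<ge> 2" "t \<ge> 2"
  shows "2 \<le> max_degree V E" "max_degree V E \<le> 2 * d + 1"
proof -
  from assms(1,3) show "2 \<le> max_degree V E" by (cases rule: admissible_cases) auto
  from assms(1,3) show "max_degree V E \<le> 2 * d + 1"
  proof (cases rule: admissible_cases)
    case degree_two
    with assms(2) show ?thesis by simp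
  next
    case large
    show ?thesis using large(2) assms(3) by (rule degree_bound_le)
  qed
qed

lemma admissible_nonempty: "admissible d t l V E \<Longrightarrow> V \<noteq> {}"
  by (auto simp: admissible_def max_degree_def)

lemma admissible_cut_side:
  assumes adm: "admissible d t l V E" and "d \<ge> 2" "t \<ge> 2" "r \<in> V"
  obtains B where "B \<subseteq> ball E {r} (cut_radius d l)" "cut_side d V E B"
proof -
  interpret finite_simple_graph V E by standard (use adm in \<open>simp add: admissible_def\<close>)
  show ?thesis
  proof (cases "degree E r \<le> d")
    case True
    then have "cut_side d V E {r}"
      using assms admissible_max_degree(1)[OF assms(1-3)] by (intro cut_side_singleton) auto
    with centre_subset_ball show ?thesis by (rule that)
  next
    case False
    from adm assms(3) show ?thesis
    proof (cases rule: admissible_cases)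
      case degree_two
      with False assms(2) degree_le_max_degree[of r] show ?thesis by linarith
    next
      case large
      have "is_free (S_verts t l) (S_edges t l) V E" using adm by (simp add: admissible_def)
      from cut_side_in_ball[OF this assms(3,4) large] that show ?thesis .
    qed
  qed
qed


section \<open>Loop-free programs\<close>

fun loop_free :: "com \<Rightarrow> bool" where
  "loop_free (Seq c c') \<longleftrightarrow> loop_free c \<and> loop_free c'"
| "loop_free (com.If b c c') \<longleftrightarrow> loop_free c \<and> loop_free c'"
| "loop_free (While b c) \<longleftrightarrow> False"
| "loop_free _ \<longleftrightarrow> True"

text \<open>The values of the next two functions on loops are irrelevant.\<close>

primrec max_time :: "com \<Rightarrow> nat" where
  "max_time Skip = 1"
| "max_time (Assign x e) = acost e + 1"
| "max_time (Put a i e) = acost i + acost e + 1"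
| "max_time (Seq c c') = max_time c + max_time c'"
| "max_time (com.If b c c') = bcost b + 1 + max (max_time c) (max_time c')"
| "max_time (While b c) = 0"

primrec run :: "com \<Rightarrow> state \<Rightarrow> state" where
  "run Skip s = s"
| "run (Assign x e) s = ((fst s)(x := aval e s), snd s)"
| "run (Put a i e) s = (fst s, (snd s)(a := (snd s a)(aval i s := aval e s)))"
| "run (Seq c c') s = run c' (run c s)"
| "run (com.If b c c') s = (if bval b s then run c s else run c' s)"
| "run (While b c) s = s"

lemma exec_run: "loop_free c \<Longrightarrow> \<exists>T\<le>max_time c. exec c s T (run c s)"
proof (induction c arbitrary: s)
  case (Seq c c')
  then obtain T T' where "T \<le> max_time c" "exec c s T (run c s)"
    "T' \<le> max_time c'" "exec c' (run c s) T' (run c' (run c s))" by (metis loop_free.simps(1))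
  then show ?case by (intro exI[of _ "T + T'"]) (auto intro: exec.Seq)
next
  case (If b c c')
  then obtain T T' where "T \<le> max_time c" "exec c s T (run c s)"
    "T' \<le> max_time c'" "exec c' s T' (run c' s)" by (metis loop_free.simps(2))
  then show ?case
    by (intro exI[of _ "bcost b + 1 + (if bval b s then T else T')"])
      (auto simp: max_def intro: exec.IfTrue[simplified] exec.IfFalse[simplified])
qed (auto intro: exec.intros[simplified])

lemma linear_time_if_loop_free:
  assumes "loop_free c"
    and correct: "\<And>adj V E. simple_graph V E \<Longrightarrow> adjacency_lists adj V E \<Longrightarrow> P V E \<Longrightarrow>
      V \<noteq> {} \<and> (\<exists>M. outputs_edges (run c (input_state adj)) M \<and> Q V E M)"
  shows "linear_time_edge_search P Q"
  unfolding linear_time_edge_search_def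
proof (rule exI[of _ c], rule exI[of _ "max_time c"], intro allI impI)
  fix adj V E
  assume G: "simple_graph V E \<and> adjacency_lists adj V E \<and> P V E"
  then obtain M where M: "outputs_edges (run c (input_state adj)) M" "Q V E M" and "V \<noteq> {}"
    using correct by blast
  obtain T where T: "T \<le> max_time c" "exec c (input_state adj) T (run c (input_state adj))"
    using exec_run[OF assms(1)] by blast
  have "1 \<le> card V"
    using G \<open>V \<noteq> {}\<close> by (simp add: simple_graph_def Suc_le_eq card_gt_0_iff)
  then have "max_time c \<le> max_time c * (card V + card E)" by simp
  with T(1) have "T \<le> max_time c * (card V + card E)" by (rule order_trans)
  with T(2) M show "\<exists>T s M. exec c (input_state adj) T s \<and>
      T \<le> max_time c * (card V + card E) \<and> outputs_edges s M \<and> Q V E M" by blast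
qed

definition implies :: "bexp \<Rightarrow> bexp \<Rightarrow> bexp" where
  "implies b b' = bexp.Not (And b (bexp.Not b'))"

primrec all_of :: "bexp list \<Rightarrow> bexp" where
  "all_of [] = Equal (Const 0) (Const 0)"
| "all_of (b # bs) = And b (all_of bs)"

fun at_most :: "nat \<Rightarrow> bexp list \<Rightarrow> bexp" where
  "at_most n [] = all_of []"
| "at_most 0 (b # bs) = And (bexp.Not b) (at_most 0 bs)"
| "at_most (Suc n) (b # bs) =
     And (implies b (at_most n bs)) (implies (bexp.Not b) (at_most (Suc n) bs))"

primrec first_match :: "(bexp \<times> com) list \<Rightarrow> com" where
  "first_match [] = Skip"
| "first_match (bc # bcs) = com.If (fst bc) (snd bc) (first_match bcs)"

lemma bval_implies [simp]: "bval (implies b b') s \<longleftrightarrow> (bval b s \<longrightarrow> bval b' s)"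
  by (simp add: implies_def)

lemma bval_all_of [simp]: "bval (all_of bs) s \<longleftrightarrow> (\<forall>b\<in>set bs. bval b s)"
  by (induction bs) auto

lemma bval_at_most [simp]: "bval (at_most n bs) s \<longleftrightarrow> length (filter (\<lambda>b. bval b s) bs) \<le> n"
  by (induction n bs rule: at_most.induct) auto

lemma aval_Inc_power [simp]: "aval ((Inc ^^ j) e) s = aval e s + j"
  by (induction j) auto

lemma loop_free_first_match: "\<forall>bc\<in>set bcs. loop_free (snd bc) \<Longrightarrow> loop_free (first_match bcs)"
  by (induction bcs) auto

lemma run_first_match:
  "\<exists>bc\<in>set bcs. bval (fst bc) s \<Longrightarrow>
    \<exists>bc\<in>set bcs. bval (fst bc) s \<and> run (first_match bcs) s = run (snd bc) s"
  by (induction bcs) auto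


section \<open>Local search from vertex 0\<close>

text \<open>A vertex is addressed by the list of choices made on a walk from vertex 0, last choice first:
  the address j # p denotes the j-th neighbour of the vertex with address p.  The expression
  for it is meaningful only if \<open>address_test\<close> succeeds.\<close>

primrec vertex_expr :: "nat list \<Rightarrow> aexp" where
  "vertex_expr [] = Const 0"
| "vertex_expr (j # p) = Get ''nbr'' ((Inc ^^ j) (Get ''off'' (vertex_expr p)))"

primrec address_test :: "nat list \<Rightarrow> bexp" where
  "address_test [] = all_of []"
| "address_test (j # p) = And (address_test p)
     (Less ((Inc ^^ j) (Get ''off'' (vertex_expr p))) (Get ''off'' (Inc (vertex_expr p))))"

definition addresses :: "nat \<Rightarrow> nat \<Rightarrow> nat list set" where
  "addresses D N = {p. set p \<subseteq> {..<D} \<and> length p \<le> N}"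

definition extensions :: "nat \<Rightarrow> nat list \<Rightarrow> nat list list" where
  "extensions D p = map (\<lambda>j. j # p) [0..<D]"

definition differs_test :: "nat list list \<Rightarrow> nat list \<Rightarrow> bexp" where
  "differs_test ps q = all_of (map (\<lambda>p. bexp.Not (Equal (vertex_expr q) (vertex_expr p))) ps)"

definition outside_test :: "nat list list \<Rightarrow> nat list \<Rightarrow> bexp" where
  "outside_test ps q = And (address_test q) (differs_test ps q)"

definition inside_test :: "nat list list \<Rightarrow> nat list \<Rightarrow> bexp" where
  "inside_test ps q = And (address_test q) (bexp.Not (differs_test ps q))"

primrec distinct_test :: "nat list list \<Rightarrow> bexp" where
  "distinct_test [] = all_of []"
| "distinct_test (p # ps) = And (differs_test ps p) (distinct_test ps)"

definition enumeration_test :: "nat list list \<Rightarrow> bexp" where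
  "enumeration_test ps = And (all_of (map address_test ps)) (distinct_test ps)"

definition size_test :: "nat list list \<Rightarrow> bexp" where
  "size_test ps =
     And (Less (Const 0) (Const (length ps))) (Less (Const (length ps)) (Var ''n''))"

definition inner_boundary_test :: "nat \<Rightarrow> nat \<Rightarrow> nat list list \<Rightarrow> bexp" where
  "inner_boundary_test d D ps =
     all_of (map (\<lambda>p. at_most d (map (outside_test ps) (extensions D p))) ps)"

definition outer_boundary_test :: "nat \<Rightarrow> nat \<Rightarrow> nat list list \<Rightarrow> bexp" where
  "outer_boundary_test d D ps =
     all_of (map
       (\<lambda>q. implies (outside_test ps q) (at_most d (map (inside_test ps) (extensions D q))))
       (concat (map (extensions D) ps)))"

definition cut_test :: "nat \<Rightarrow> nat \<Rightarrow> nat list list \<Rightarrow> bexp" where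
  "cut_test d D ps = all_of
     [enumeration_test ps, size_test ps, inner_boundary_test d D ps, outer_boundary_test d D ps]"

definition emit_edge :: "nat list \<Rightarrow> nat list \<Rightarrow> com" where
  "emit_edge p q =
     Seq (Put ''src'' (Var ''k'') (vertex_expr p))
       (Seq (Put ''dst'' (Var ''k'') (vertex_expr q)) (Assign ''k'' (Inc (Var ''k''))))"

fun emit_leaving :: "nat list list \<Rightarrow> (nat list \<times> nat list) list \<Rightarrow> com" where
  "emit_leaving ps [] = Skip"
| "emit_leaving ps ((p, q) # pqs) =
     Seq (com.If (outside_test ps q) (emit_edge p q) Skip) (emit_leaving ps pqs)"

definition emit_cut :: "nat \<Rightarrow> nat list list \<Rightarrow> com" where
  "emit_cut D ps = emit_leaving ps (concat (map (\<lambda>p. map (Pair p) (extensions D p)) ps))"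

definition cut_search :: "nat \<Rightarrow> nat \<Rightarrow> nat list list list \<Rightarrow> com" where
  "cut_search d D pss = first_match (map (\<lambda>ps. (cut_test d D ps, emit_cut D ps)) pss)"

definition emitted :: "state \<Rightarrow> (nat \<times> nat) list" where
  "emitted s = map (\<lambda>i. (snd s ''src'' i, snd s ''dst'' i)) [0..<fst s ''k'']"

lemma finite_addresses: "finite (addresses D N)"
  unfolding addresses_def by (rule finite_lists_length_le) simp

lemma loop_free_emit_leaving: "loop_free (emit_leaving ps pqs)"
  by (induction ps pqs rule: emit_leaving.induct) (auto simp: emit_edge_def)

lemma loop_free_cut_search: "loop_free (cut_search d D pss)"
  unfolding cut_search_def
  by (rule loop_free_first_match) (auto simp: emit_cut_def loop_free_emit_leaving)

lemma outputs_edges_if_emitted: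
  assumes "M = (\<lambda>(u, v). {u, v}) ` set (emitted s)" "card M = length (emitted s)"
  shows "outputs_edges s M"
  using assms by (auto simp: outputs_edges_def emitted_def)


section \<open>Correctness of the search\<close>

locale adjacency_input = finite_simple_graph V E for V :: "nat set" and E +
  fixes adj :: "nat list list" and D :: nat
  assumes adjacency: "adjacency_lists adj V E"
    and nonempty: "V \<noteq> {}"
    and degree_le: "degree E v \<le> D"
begin

lemma V_eq: "V = {..<length adj}"
  using adjacency by (simp add: adjacency_lists_def)

lemma set_adj: "v \<in> V \<Longrightarrow> set (adj ! v) = nbrs E v"
  using adjacency by (auto simp: adjacency_lists_def)

lemma distinct_adj: "v \<in> V \<Longrightarrow> distinct (adj ! v)"
  using adjacency by (auto simp: adjacency_lists_def)

lemma length_filter_adj: "v \<in> V \<Longrightarrow> length (filter P (adj ! v)) = card {u \<in> nbrs E v. P u}"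
  using distinct_card[of "filter P (adj ! v)"] distinct_adj[of v] set_adj[of v] by simp

lemma length_adj: "v \<in> V \<Longrightarrow> length (adj ! v) \<le> D"
  using length_filter_adj[of v "\<lambda>_. True"] degree_le[of v] by (simp add: degree_def)

primrec vertex_at :: "nat list \<Rightarrow> nat" where
  "vertex_at [] = 0"
| "vertex_at (j # p) = adj ! vertex_at p ! j"

primrec is_address :: "nat list \<Rightarrow> bool" where
  "is_address [] \<longleftrightarrow> True"
| "is_address (j # p) \<longleftrightarrow> is_address p \<and> j < length (adj ! vertex_at p)"

definition enumerates :: "nat list list \<Rightarrow> nat set \<Rightarrow> bool" where
  "enumerates ps B \<longleftrightarrow>
     (\<forall>p\<in>set ps. is_address p) \<and> distinct (map vertex_at ps) \<and> vertex_at ` set ps = B"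

definition stores_input :: "state \<Rightarrow> bool" where
  "stores_input s \<longleftrightarrow> fst s ''n'' = length adj \<and>
     snd s ''off'' = snd (input_state adj) ''off'' \<and>
     snd s ''nbr'' = snd (input_state adj) ''nbr''"

lemma vertex_at_in_V: "is_address p \<Longrightarrow> vertex_at p \<in> V"
proof (induction p)
  case Nil
  with nonempty show ?case by (auto simp: V_eq)
next
  case (Cons j p)
  then have "vertex_at (j # p) \<in> nbrs E (vertex_at p)" using set_adj by (auto dest: nth_mem)
  then show ?case using nbrs_subset by blast
qed

lemma vertex_at_extensions:
  assumes "is_address p"
  shows "map vertex_at (filter is_address (extensions D p)) = adj ! vertex_at p"
proof -
  let ?xs = "adj ! vertex_at p"
  have "[0..<D] = [0..<length ?xs] @ [length ?xs..<D]"
    using upt_add_eq_append[of 0 "length ?xs" "D - length ?xs"]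
      length_adj[OF vertex_at_in_V[OF assms]] by simp
  then have "filter is_address (extensions D p) = map (\<lambda>j. j # p) [0..<length ?xs]"
    using assms by (simp add: extensions_def filter_map comp_def filter_id_conv filter_empty_conv)
  then show ?thesis by (simp add: comp_def map_nth)
qed

lemma vertex_at_filter_extensions:
  assumes "is_address p"
  shows "map vertex_at (filter (\<lambda>q. is_address q \<and> P (vertex_at q)) (extensions D p)) =
    filter P (adj ! vertex_at p)"
proof -
  have "filter (\<lambda>q. is_address q \<and> P (vertex_at q)) (extensions D p) =
      filter (\<lambda>q. P (vertex_at q)) (filter is_address (extensions D p))"
    by (simp add: conj_commute)
  then show ?thesis
    by (simp add: vertex_at_extensions[OF assms, symmetric] filter_map comp_def)
qed

lemma count_extensions:
  assumes "is_address p"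
  shows "length (filter (\<lambda>q. is_address q \<and> P (vertex_at q)) (extensions D p)) =
    card {u \<in> nbrs E (vertex_at p). P u}"
  using arg_cong[OF vertex_at_filter_extensions[OF assms], of length P]
    length_filter_adj[OF vertex_at_in_V[OF assms]] by simp

lemma nbrs_eq_extensions:
  assumes "is_address p"
  shows "nbrs E (vertex_at p) = vertex_at ` {q \<in> set (extensions D p). is_address q}"
  using arg_cong[OF vertex_at_extensions[OF assms], of set]
    set_adj[OF vertex_at_in_V[OF assms]] by simp

lemma ball_address:
  "v \<in> ball E {0} i \<Longrightarrow> \<exists>p\<in>addresses D i. is_address p \<and> vertex_at p = v"
proof (induction i arbitrary: v)
  case 0
  then show ?case by (intro bexI[of _ "[]"]) (auto simp: addresses_def)
next
  case (Suc i)
  from Suc.prems consider (inner) "v \<in> ball E {0} i"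
    | (nbr) u where "u \<in> ball E {0} i" "v \<in> nbrs E u" by auto
  then show ?case
  proof cases
    case inner
    with Suc.IH obtain p where "p \<in> addresses D i" "is_address p" "vertex_at p = v" by blast
    then show ?thesis by (intro bexI[of _ p]) (auto simp: addresses_def)
  next
    case nbr
    with Suc.IH obtain p where p: "p \<in> addresses D i" "is_address p" "vertex_at p = u" by blast
    then obtain q where "q \<in> set (extensions D p)" "is_address q" "vertex_at q = v"
      using nbrs_eq_extensions[OF p(2)] nbr by auto
    with p(1) show ?thesis
      by (intro bexI[of _ q]) (auto simp: addresses_def extensions_def)
  qed
qed

lemma enumeration_in_ball:
  assumes "B \<subseteq> ball E {0} N" "finite B"
  obtains ps where "set ps \<subseteq> addresses D N" "distinct ps" "enumerates ps B"
proof -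
  from assms(1) ball_address have "\<forall>v\<in>B. \<exists>p\<in>addresses D N. is_address p \<and> vertex_at p = v"
    by blast
  then obtain f where f: "\<forall>v\<in>B. f v \<in> addresses D N \<and> is_address (f v) \<and> vertex_at (f v) = v"
    by metis
  obtain vs where vs: "set vs = B" "distinct vs" using finite_distinct_list[OF assms(2)] by blast
  have vertices: "map vertex_at (map f vs) = vs" using f vs(1) by (auto intro: map_idI)
  then have "vertex_at ` set (map f vs) = B" using vs(1) by (metis set_map)
  with vertices f vs have "enumerates (map f vs) B" by (auto simp: enumerates_def)
  moreover have "distinct (map f vs)" using vertices vs(2) by (metis distinct_map)
  moreover have "set (map f vs) \<subseteq> addresses D N" using f vs(1) by auto
  ultimately show ?thesis using that by blast
qed

lemma enumerates_subset: "enumerates ps B \<Longrightarrow> B \<subseteq> V"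
  using vertex_at_in_V by (auto simp: enumerates_def)

lemma length_enumeration: "enumerates ps B \<Longrightarrow> length ps = card B"
  unfolding enumerates_def by (metis distinct_card length_map set_map)

lemma off_input:
  "v \<le> length adj \<Longrightarrow> snd (input_state adj) ''off'' v = length (concat (take v adj))"
  by (simp add: input_state_def)

lemma nbr_input:
  assumes "v < length adj" "j < length (adj ! v)"
  shows "snd (input_state adj) ''nbr'' (length (concat (take v adj)) + j) = adj ! v ! j"
proof -
  have "concat adj = concat (take v adj) @ adj ! v @ concat (drop (Suc v) adj)"
    using id_take_nth_drop[OF assms(1)] by (metis concat.simps(2) concat_append)
  then show ?thesis using assms(2) by (simp add: input_state_def nth_append)
qed

lemma stores_input_input_state: "stores_input (input_state adj)"
  by (simp add: stores_input_def input_state_def)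

context
  fixes s assumes stores: "stores_input s"
begin

lemma address_test_and_vertex_expr:
  "(bval (address_test p) s \<longleftrightarrow> is_address p) \<and> (is_address p \<longrightarrow> aval (vertex_expr p) s = vertex_at p)"
proof (induction p)
  case (Cons j p)
  show ?case
  proof (cases "is_address p")
    case True
    then have "vertex_at p < length adj" using vertex_at_in_V V_eq by auto
    with True Cons.IH stores show ?thesis
      by (auto simp: stores_input_def off_input nbr_input take_Suc_conv_app_nth)
  qed (use Cons.IH in simp)
qed simp

lemma bval_address_test: "bval (address_test p) s \<longleftrightarrow> is_address p"
  and aval_vertex_expr: "is_address p \<Longrightarrow> aval (vertex_expr p) s = vertex_at p"
  using address_test_and_vertex_expr by simp_all

lemma bval_differs_test:
  assumes "\<forall>p\<in>set ps. is_address p" "is_address q"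
  shows "bval (differs_test ps q) s \<longleftrightarrow> vertex_at q \<notin> vertex_at ` set ps"
  using assms by (auto simp: differs_test_def aval_vertex_expr)

lemma bval_distinct_test:
  "\<forall>p\<in>set ps. is_address p \<Longrightarrow> bval (distinct_test ps) s \<longleftrightarrow> distinct (map vertex_at ps)"
  by (induction ps) (auto simp: bval_differs_test)

lemma bval_enumeration_test:
  "bval (enumeration_test ps) s \<longleftrightarrow> enumerates ps (vertex_at ` set ps)"
  by (auto simp: enumeration_test_def enumerates_def bval_address_test bval_distinct_test)

context
  fixes ps B assumes ps: "enumerates ps B"
begin

lemma bval_outside_test: "bval (outside_test ps q) s \<longleftrightarrow> is_address q \<and> vertex_at q \<notin> B"
  and bval_inside_test: "bval (inside_test ps q) s \<longleftrightarrow> is_address q \<and> vertex_at q \<in> B"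
  using ps bval_differs_test[of ps q]
  by (auto simp: enumerates_def outside_test_def inside_test_def bval_address_test)

lemma bval_size_test: "bval (size_test ps) s \<longleftrightarrow> B \<noteq> {} \<and> B \<subset> V"
proof -
  have "finite B" using enumerates_subset[OF ps] finite_V by (rule finite_subset)
  moreover have "card B < card V \<longleftrightarrow> B \<subset> V"
    using enumerates_subset[OF ps] finite_V psubset_card_mono[of V B] by auto
  ultimately show ?thesis
    using stores
    by (simp add: size_test_def stores_input_def length_enumeration[OF ps] V_eq card_gt_0_iff)
qed

lemma bval_inner_boundary_test: "bval (inner_boundary_test d D ps) s \<longleftrightarrow> sparse_boundary E d B"
proof -
  have "length (filter (\<lambda>q. bval (outside_test ps q) s) (extensions D p)) =
      card (nbrs E (vertex_at p) - B)" if "p \<in> set ps" for p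
    using that ps count_extensions[of p "\<lambda>u. u \<notin> B"]
    by (simp add: enumerates_def bval_outside_test set_diff_eq)
  then show ?thesis
    using ps
    by (auto simp: inner_boundary_test_def sparse_boundary_def filter_map comp_def enumerates_def)
qed

lemma vertex_at_concat_extensions:
  "vertex_at ` {q \<in> set (concat (map (extensions D) ps)). is_address q} = (\<Union>b\<in>B. nbrs E b)"
proof -
  have "(\<Union>b\<in>B. nbrs E b) = (\<Union>p\<in>set ps. nbrs E (vertex_at p))"
    using ps by (auto simp: enumerates_def)
  also have "\<dots> = (\<Union>p\<in>set ps. vertex_at ` {q \<in> set (extensions D p). is_address q})"
    using ps nbrs_eq_extensions by (simp add: enumerates_def)
  finally show ?thesis by auto
qed

lemma bval_outer_boundary_test:
  "bval (outer_boundary_test d D ps) s \<longleftrightarrow> sparse_boundary E d (V - B)"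
proof -
  have count: "length (filter (\<lambda>q'. bval (inside_test ps q') s) (extensions D q)) =
      card (nbrs E (vertex_at q) \<inter> B)" if "is_address q" for q
    using count_extensions[OF that, of "\<lambda>u. u \<in> B"] by (simp add: bval_inside_test Int_def)
  have "bval (outer_boundary_test d D ps) s \<longleftrightarrow>
      (\<forall>u\<in>vertex_at ` {q \<in> set (concat (map (extensions D) ps)). is_address q}.
        u \<notin> B \<longrightarrow> card (nbrs E u \<inter> B) \<le> d)"
    by (auto simp: outer_boundary_test_def bval_outside_test filter_map comp_def count)
  also have "\<dots> \<longleftrightarrow> (\<forall>u\<in>\<Union>b\<in>B. nbrs E b. u \<notin> B \<longrightarrow> card (nbrs E u \<inter> B) \<le> d)"
    unfolding vertex_at_concat_extensions ..
  also have "\<dots> \<longleftrightarrow> (\<forall>u\<in>V - B. card (nbrs E u \<inter> B) \<le> d)"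
  proof (intro iffI ballI impI)
    fix u assume near: "\<forall>u\<in>\<Union>b\<in>B. nbrs E b. u \<notin> B \<longrightarrow> card (nbrs E u \<inter> B) \<le> d" and "u \<in> V - B"
    show "card (nbrs E u \<inter> B) \<le> d"
    proof (cases "nbrs E u \<inter> B = {}")
      case False
      then have "u \<in> (\<Union>b\<in>B. nbrs E b)" using nbrs_sym[of u E] by auto
      with near \<open>u \<in> V - B\<close> show ?thesis by blast
    qed simp
  qed (use nbrs_subset in blast)
  finally show ?thesis by (simp add: sparse_boundary_def nbrs_diff_complement)
qed

end

lemma bval_cut_test:
  "bval (cut_test d D ps) s \<longleftrightarrow> (\<exists>B. enumerates ps B \<and> cut_side d V E B)"
proof -
  have "bval (cut_test d D ps) s \<longleftrightarrow> cut_side d V E B" if "enumerates ps B" for B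
  proof -
    have "B = vertex_at ` set ps" using that by (simp add: enumerates_def)
    with that show ?thesis
      by (simp add: cut_test_def cut_side_def bval_enumeration_test bval_size_test[OF that]
          bval_inner_boundary_test[OF that] bval_outer_boundary_test[OF that])
  qed
  moreover have "enumerates ps (vertex_at ` set ps)" if "bval (cut_test d D ps) s"
    using that by (simp add: cut_test_def bval_enumeration_test)
  ultimately show ?thesis by blast
qed

end

lemma run_emit_edge:
  assumes "stores_input s" "is_address p" "is_address q"
  shows "stores_input (run (emit_edge p q) s)"
    and "emitted (run (emit_edge p q) s) = emitted s @ [(vertex_at p, vertex_at q)]"
proof -
  let ?s' = "run (Put ''src'' (Var ''k'') (vertex_expr p)) s"
  have "stores_input ?s'" using assms(1) by (simp add: stores_input_def)
  then have "aval (vertex_expr q) ?s' = vertex_at q" using assms(3) by (rule aval_vertex_expr)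
  then show "emitted (run (emit_edge p q) s) = emitted s @ [(vertex_at p, vertex_at q)]"
    using aval_vertex_expr[OF assms(1,2)] by (simp add: emitted_def emit_edge_def)
  show "stores_input (run (emit_edge p q) s)"
    using assms(1) by (simp add: stores_input_def emit_edge_def)
qed

lemma emitted_run_emit_leaving:
  assumes "enumerates ps B" "stores_input s" "\<forall>(p, q)\<in>set pqs. is_address p"
  shows "emitted (run (emit_leaving ps pqs) s) = emitted s @
    map (map_prod vertex_at vertex_at) (filter (\<lambda>(p, q). is_address q \<and> vertex_at q \<notin> B) pqs)"
  using assms(2,3)
proof (induction pqs arbitrary: s)
  case (Cons pq pqs)
  obtain p q where pq: "pq = (p, q)" by (cases pq)
  show ?case
  proof (cases "is_address q \<and> vertex_at q \<notin> B")
    case True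
    with Cons pq run_emit_edge[of s p q] show ?thesis
      by (simp add: bval_outside_test[OF Cons.prems(1) assms(1)])
  next
    case False
    with Cons pq show ?thesis by (auto simp: bval_outside_test[OF Cons.prems(1) assms(1)])
  qed
qed simp

lemma emitted_run_emit_cut:
  assumes "enumerates ps B"
  shows "emitted (run (emit_cut D ps) (input_state adj)) =
    concat (map (\<lambda>v. map (Pair v) (filter (\<lambda>u. u \<notin> B) (adj ! v))) (map vertex_at ps))"
proof -
  let ?leaving = "\<lambda>p. filter (\<lambda>q. is_address q \<and> vertex_at q \<notin> B) (extensions D p)"
  have ps: "\<forall>p\<in>set ps. is_address p" using assms by (simp add: enumerates_def)
  have "emitted (input_state adj) = []" by (simp add: emitted_def input_state_def)
  then have "emitted (run (emit_cut D ps) (input_state adj)) =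
      map (map_prod vertex_at vertex_at) (filter (\<lambda>(p, q). is_address q \<and> vertex_at q \<notin> B)
        (concat (map (\<lambda>p. map (Pair p) (extensions D p)) ps)))"
    unfolding emit_cut_def
    using emitted_run_emit_leaving[OF assms stores_input_input_state] ps by simp
  also have "\<dots> = concat (map (\<lambda>p. map (Pair (vertex_at p)) (map vertex_at (?leaving p))) ps)"
    by (simp add: filter_concat map_concat filter_map comp_def)
  also have "\<dots> = concat (map (\<lambda>p. map (Pair (vertex_at p))
      (filter (\<lambda>u. u \<notin> B) (adj ! vertex_at p))) ps)"
    using ps vertex_at_filter_extensions[of _ "\<lambda>u. u \<notin> B"]
    by (intro arg_cong[of _ _ concat] map_cong) auto
  finally show ?thesis by (simp add: comp_def)
qed

lemma outputs_edges_emit_cut: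
  assumes "enumerates ps B"
  shows "outputs_edges (run (emit_cut D ps) (input_state adj)) (cut_edges V E B)"
proof (rule outputs_edges_if_emitted)
  let ?vs = "map vertex_at ps" and ?L = "emitted (run (emit_cut D ps) (input_state adj))"
  have vs: "set ?vs = B" "distinct ?vs" using assms by (auto simp: enumerates_def)
  have B_subset: "B \<subseteq> V" using assms by (rule enumerates_subset)
  have "set ?L = (SIGMA b:B. nbrs E b - B)"
    unfolding emitted_run_emit_cut[OF assms] set_concat set_map[of _ ?vs] vs(1)
    using B_subset set_adj by (auto simp: image_iff)
  then show "cut_edges V E B = (\<lambda>(u, v). {u, v}) ` set ?L" by (simp add: cut_edges_eq_image)
  have "length ?L = (\<Sum>v\<leftarrow>?vs. length (filter (\<lambda>u. u \<notin> B) (adj ! v)))"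
    unfolding emitted_run_emit_cut[OF assms] by (simp add: length_concat comp_def)
  also have "\<dots> = (\<Sum>v\<in>B. length (filter (\<lambda>u. u \<notin> B) (adj ! v)))"
    using sum_list_distinct_conv_sum_set[OF vs(2)] vs(1) by metis
  also have "\<dots> = boundary_size E B"
    unfolding boundary_size_def using B_subset length_filter_adj
    by (intro sum.cong) (auto simp: set_diff_eq)
  finally show "card (cut_edges V E B) = length ?L"
    using card_cut_edges[of B] vs(1) by (metis List.finite_set)
qed

lemma run_cut_search:
  assumes "B \<subseteq> ball E {0} N" "cut_side d V E B"
    and pss: "set pss = {ps. set ps \<subseteq> addresses D N \<and> distinct ps}"
  shows "\<exists>M. outputs_edges (run (cut_search d D pss) (input_state adj)) M \<and> d_cut d V E M"
proof -
  have "finite B" using assms(2) finite_V finite_subset unfolding cut_side_def by blast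
  with assms(1) obtain ps where "ps \<in> set pss" "enumerates ps B"
    using pss by (auto elim: enumeration_in_ball)
  then have "\<exists>ps\<in>set pss. bval (cut_test d D ps) (input_state adj)"
    using bval_cut_test[OF stores_input_input_state] assms(2) by blast
  then obtain ps' where "bval (cut_test d D ps') (input_state adj)" and run:
    "run (cut_search d D pss) (input_state adj) = run (emit_cut D ps') (input_state adj)"
    using run_first_match[of "map (\<lambda>ps. (cut_test d D ps, emit_cut D ps)) pss" "input_state adj"]
    by (auto simp: cut_search_def)
  then obtain B' where "enumerates ps' B'" "cut_side d V E B'"
    using bval_cut_test[OF stores_input_input_state] by blast
  then show ?thesis
    unfolding run using outputs_edges_emit_cut d_cut_if_cut_side by blast
qed

end

lemma linear_time_d_cut_if_local:
  assumes bounded: "\<And>V E. P V E \<Longrightarrow> V \<noteq> {} \<and> max_degree V E \<le> D"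
    and near: "\<And>V E r. P V E \<Longrightarrow> r \<in> V \<Longrightarrow> \<exists>B\<subseteq>ball E {r} N. cut_side d V E B"
  shows "linear_time_edge_search P (d_cut d)"
proof -
  have "finite {ps. set ps \<subseteq> addresses D N \<and> distinct ps}"
    using finite_addresses by (rule finite_subset_distinct)
  from finite_list[OF this]
  obtain pss where pss: "set pss = {ps. set ps \<subseteq> addresses D N \<and> distinct ps}" ..
  show ?thesis
  proof (rule linear_time_if_loop_free[OF loop_free_cut_search])
    fix adj V E
    assume G: "simple_graph V E" "adjacency_lists adj V E" "P V E"
    interpret finite_simple_graph V E by standard fact
    have "V \<noteq> {}" "max_degree V E \<le> D" using bounded[OF G(3)] by simp_all
    then interpret adjacency_input V E adj D
      using G(2) order_trans[OF degree_le_max_degree] by unfold_locales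
    have "0 \<in> V" using vertex_at_in_V[of "[]"] by simp
    from near[OF G(3) this] obtain B where "B \<subseteq> ball E {0} N" "cut_side d V E B" by blast
    from nonempty run_cut_search[OF this pss]
    show "V \<noteq> {} \<and>
      (\<exists>M. outputs_edges (run (cut_search d D pss) (input_state adj)) M \<and> d_cut d V E M)" ..
  qed
qed

theorem theorem3p2:
  fixes d t l :: nat
  assumes "d \<ge> 2" and "t \<ge> 2" and "l \<ge> 1"
  shows "(\<forall>(V :: 'a set) E. admissible d t l V E \<longrightarrow> (\<exists>M. d_cut d V E M)) \<and>
         linear_time_edge_search (admissible d t l) (d_cut d)"
proof (intro conjI allI impI)
  fix V :: "'a set" and E
  assume adm: "admissible d t l V E"
  then interpret finite_simple_graph V E by unfold_locales (simp add: admissible_def)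
  obtain r where "r \<in> V" using admissible_nonempty[OF adm] by blast
  with adm assms(1,2) obtain B where "cut_side d V E B" by (rule admissible_cut_side)
  then show "\<exists>M. d_cut d V E M" using d_cut_if_cut_side by blast
next
  show "linear_time_edge_search (admissible d t l) (d_cut d)"
  proof (rule linear_time_d_cut_if_local)
    show "V \<noteq> {} \<and> max_degree V E \<le> 2 * d + 1" if "admissible d t l V E" for V :: "nat set" and E
      using that admissible_nonempty admissible_max_degree assms(1,2) by blast
    show "\<exists>B\<subseteq>ball E {r} (cut_radius d l). cut_side d V E B"
      if "admissible d t l V E" "r \<in> V" for V :: "nat set" and E r
      using that assms(1,2) by (metis admissible_cut_side)
  qed
qed

end
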